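(* For every fixed integer $k\ge1$, $|c(n,k)-2^{n+1}|=O(1)$ as a function of $n$; that is, for every integer $k\ge 1$ there is a constant $D_k$ such that $|c(n,k)-2^{n+1}|\le D_k$ for all integers $n\ge1$.
   Context: For integers $n\ge1$, $k\ge0$, $c(n,k)$ denotes the least integer such that for every $m$, every matrix $A\in\mathbb{R}^{m\times n}$ and every $b\in\mathbb{R}^m$: if the polyhedron $\{x\in\mathbb{R}^n : Ax\le b\}$ contains exactly $k$ integer points (points of $\mathbb{Z}^n$), then there is a subset $I$ of the rows of $A$ with $|I|\le c(n,k)$ such that $\{x\in\mathbb{R}^n : A_Ix\le b_I\}$ contains exactly the same $k$ integer points, where $A_I,b_I$ are the restrictions to the rows in $I$. *)

theory Defs
  imports Complex_Main "Jordan_Normal_Form.Matrix"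
begin

definition int_vecs :: "nat \<Rightarrow> real vec set" where
  "int_vecs n = {x \<in> carrier_vec n. \<forall>i<n. x $ i \<in> \<int>}"

definition polyhedron_of :: "real mat \<Rightarrow> real vec \<Rightarrow> real vec set" where
  "polyhedron_of A b = {x \<in> carrier_vec (dim_col A). A *\<^sub>v x \<le> b}"

text \<open>The polyhedron of the restricted system is written row by row, which avoids re-indexing
  the matrix with row set \<open>I\<close>; the index set \<open>I\<close> counts repeated rows separately.\<close>

definition subpolyhedron_of :: "real mat \<Rightarrow> real vec \<Rightarrow> nat set \<Rightarrow> real vec set" where
  "subpolyhedron_of A b I = {x \<in> carrier_vec (dim_col A). \<forall>i\<in>I. (A *\<^sub>v x) $ i \<le> b $ i}"

text \<open>Finiteness is required separately below because \<open>card\<close> of an infinite set is 0.\<close>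

definition subsystem_bound :: "nat \<Rightarrow> nat \<Rightarrow> nat \<Rightarrow> bool" where
  "subsystem_bound n k c \<longleftrightarrow>
    (\<forall>m. \<forall>A \<in> carrier_mat m n. \<forall>b \<in> carrier_vec m.
      finite (polyhedron_of A b \<inter> int_vecs n) \<and> card (polyhedron_of A b \<inter> int_vecs n) = k \<longrightarrow>
      (\<exists>I \<subseteq> {..<m}. card I \<le> c \<and>
        subpolyhedron_of A b I \<inter> int_vecs n = polyhedron_of A b \<inter> int_vecs n))"

text \<open>The number \<open>c(n,k)\<close>. Taking the least natural number agrees with taking the least integer:
  for \<open>n \<ge> 1\<close> and every \<open>k\<close> some polyhedron has exactly \<open>k\<close> integer points,
  so no negative integer is a bound on \<open>card I\<close>.\<close>

definition helly_c :: "nat \<Rightarrow> nat \<Rightarrow> nat" where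
  "helly_c n k = (LEAST c. subsystem_bound n k c)"

end

theory Submission
  imports Defs
begin

text \<open>
  The term \<open>2\<^sup>n\<^sup>+\<^sup>1\<close> arises as two points for each of the \<open>2\<^sup>n\<close> parity classes of \<open>\<int>\<^sup>n\<close>.

  Upper bound. Take a smallest subsystem with the same set \<open>K\<close> of \<open>k\<close> integer points. Dropping any of its
  constraints lets in a new integer point. Pushing the constraints outwards one after the other until
  each of them touches such a point (lemma \<open>push_constraints\<close>) gives one integer point per constraint, lying
  on that constraint and strictly inside all others, while every integer point strictly inside all
  pushed constraints (and in a fixed large box) is still in \<open>K\<close>. The midpoint of two of these contact points
  is strictly inside all pushed constraints; so if the two are congruent modulo 2, their midpoint is
  in \<open>K\<close>. A triangle is determined by the midpoints of its sides, hence at most \<open>k\<^sup>3\<close> contact points lie in a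
  parity class containing three or more of them, and the other classes contribute at most two points
  each (lemma \<open>card_le_by_midpoints\<close>). Hence \<open>c(n,k) \<le> 2\<^sup>n\<^sup>+\<^sup>1 + k\<^sup>3\<close>.

  Lower bound. The polytope given by \<open>\<bar>x\<^sub>i\<bar> \<le> 1\<close> and \<open>\<bar>x\<^sub>i - x\<^sub>j\<bar> \<le> 1\<close> contains exactly the integer points \<open>0\<close> and
  \<open>\<plusminus>1\<^sub>S\<close> for nonempty \<open>S\<close>, and each of the \<open>2(2\<^sup>n - 1)\<close> nonzero ones can be cut off from all the rest by
  a single inequality (lemma \<open>sat_cut_off_sgn_ind\<close>). Cutting off all but \<open>k - 1\<close> of them leaves exactly \<open>k\<close> integer
  points, and none of the cutting inequalities can be dropped. Hence \<open>c(n,k) \<ge> 2\<^sup>n\<^sup>+\<^sup>1 - k - 1\<close>.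
\<close>

section \<open>Pushing constraints outwards\<close>

text \<open>The constraints \<open>f i x \<le> b i\<close> are processed in any order. When the turn of \<open>i\<close> comes, it is replaced by the
  strict constraint \<open>f i x < f i w\<close>, where \<open>w\<close> violates \<open>i\<close> but no other current constraint and has the least
  value of \<open>f i\<close> among such points. Minimality means that no further point of \<open>F\<close> becomes feasible; and since
  constraints only get weaker, the points chosen before and the points that witness the necessity of
  later constraints remain usable.\<close>

lemma push_constraints:
  fixes f :: "'i \<Rightarrow> 'a \<Rightarrow> 'b::linorder"
  assumes "finite I" "finite F"
    and z: "\<And>i. i \<in> I \<Longrightarrow> \<exists>z\<in>F. b i < f i z \<and> (\<forall>j\<in>I - {i}. f j z \<le> b j)"
  obtains v where "\<And>i. i \<in> I \<Longrightarrow> v i \<in> F"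
    and "\<And>i j. i \<in> I \<Longrightarrow> j \<in> I \<Longrightarrow> i \<noteq> j \<Longrightarrow> f i (v j) < f i (v i)"
    and "\<And>x i. x \<in> F \<Longrightarrow> (\<And>i. i \<in> I \<Longrightarrow> f i x < f i (v i)) \<Longrightarrow> i \<in> I \<Longrightarrow> f i x \<le> b i"
proof -
  \<comment> \<open>\<open>J\<close> collects the constraints that have already been pushed; those in \<open>I - J\<close> are the original ones.\<close>
  have "\<exists>v. (\<forall>j\<in>J. v j \<in> F \<and> b j < f j (v j) \<and> (\<forall>i\<in>J - {j}. f i (v j) < f i (v i))
              \<and> (\<forall>i\<in>I - J. f i (v j) \<le> b i))
          \<and> (\<forall>x\<in>F. (\<forall>i\<in>J. f i x < f i (v i)) \<and> (\<forall>i\<in>I - J. f i x \<le> b i)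
              \<longrightarrow> (\<forall>i\<in>J. f i x \<le> b i))"
    if "J \<subseteq> I" for J
    using finite_subset[OF that \<open>finite I\<close>] that
  proof (induction J rule: finite_induct)
    case empty
    then show ?case by simp
  next
    case (insert i J)
    then obtain v where IH: "\<forall>j\<in>J. v j \<in> F \<and> b j < f j (v j) \<and> (\<forall>i\<in>J - {j}. f i (v j) < f i (v i))
              \<and> (\<forall>i\<in>I - J. f i (v j) \<le> b i)"
      and tight: "\<forall>x\<in>F. (\<forall>i\<in>J. f i x < f i (v i)) \<and> (\<forall>i\<in>I - J. f i x \<le> b i)
              \<longrightarrow> (\<forall>i\<in>J. f i x \<le> b i)"
      by auto
    have v: "\<And>j. j \<in> J \<Longrightarrow> v j \<in> F" "\<And>j. j \<in> J \<Longrightarrow> b j < f j (v j)"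
        "\<And>i j. j \<in> J \<Longrightarrow> i \<in> J \<Longrightarrow> i \<noteq> j \<Longrightarrow> f i (v j) < f i (v i)"
        "\<And>i j. j \<in> J \<Longrightarrow> i \<in> I - J \<Longrightarrow> f i (v j) \<le> b i"
      using IH by blast+
    have i: "i \<in> I" "i \<notin> J" and J: "J \<subseteq> I" using insert by auto
    define X where "X = {x \<in> F. b i < f i x \<and> (\<forall>j\<in>J. f j x < f j (v j))
        \<and> (\<forall>l\<in>I - insert i J. f l x \<le> b l)}"
    obtain y where y: "y \<in> F" "b i < f i y" "\<And>j. j \<in> I - {i} \<Longrightarrow> f j y \<le> b j"
      using z[OF i(1)] by blast
    have "f j y < f j (v j)" if "j \<in> J" for j
      using y(3)[of j] v(2)[OF that] that i J by fastforce
    then have "y \<in> X"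
      unfolding X_def using y by simp
    moreover have "finite X" unfolding X_def using \<open>finite F\<close> by simp
    ultimately obtain w where w: "w \<in> X" and wmin: "\<And>x. x \<in> X \<Longrightarrow> f i w \<le> f i x"
      using arg_min_if_finite[of X "f i"] by (metis empty_iff not_le)
    let ?v = "v(i := w)"
    have vb: "f i (v j) < f i w" if "j \<in> J" for j
    proof -
      have "f i (v j) \<le> b i" using v(4)[OF that] i by simp
      also have "b i < f i w" using w unfolding X_def by simp
      finally show ?thesis .
    qed
    have w': "w \<in> F" "b i < f i w" "\<And>j. j \<in> J \<Longrightarrow> f j w < f j (v j)"
        "\<And>l. l \<in> I - insert i J \<Longrightarrow> f l w \<le> b l"
      using w unfolding X_def by blast+
    have A: "\<forall>j\<in>insert i J. ?v j \<in> F \<and> b j < f j (?v j)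
          \<and> (\<forall>l\<in>insert i J - {j}. f l (?v j) < f l (?v l))
          \<and> (\<forall>l\<in>I - insert i J. f l (?v j) \<le> b l)"
    proof
      fix j assume "j \<in> insert i J"
      then consider "j = i" | "j \<in> J" "j \<noteq> i" using i by blast
      then show "?v j \<in> F \<and> b j < f j (?v j) \<and> (\<forall>l\<in>insert i J - {j}. f l (?v j) < f l (?v l))
          \<and> (\<forall>l\<in>I - insert i J. f l (?v j) \<le> b l)"
        by cases (use v w' vb in auto)
    qed
    have B: "\<forall>l\<in>insert i J. f l x \<le> b l" if x: "x \<in> F" "\<forall>l\<in>insert i J. f l x < f l (?v l)"
        "\<forall>l\<in>I - insert i J. f l x \<le> b l" for x
    proof -
      have xJ: "\<forall>j\<in>J. f j x < f j (v j)" and xi: "f i x < f i w" using x(2) i by (auto split: if_splits)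
      have "x \<notin> X" using wmin[of x] xi by auto
      then have "f i x \<le> b i" using x xJ unfolding X_def by (auto simp: not_less)
      then show ?thesis using tight x(1) xJ x(3) by auto
    qed
    show ?case using A B by blast
  qed
  from this[OF order_refl] obtain v where v: "\<forall>j\<in>I. v j \<in> F \<and> (\<forall>i\<in>I - {j}. f i (v j) < f i (v i))"
      "\<forall>x\<in>F. (\<forall>i\<in>I. f i x < f i (v i)) \<longrightarrow> (\<forall>i\<in>I. f i x \<le> b i)"
    by auto
  show ?thesis by (rule that[of v]) (use v in auto)
qed

section \<open>Counting points by parity class\<close>

text \<open>For points of a vector space, \<open>R a b c = a + b - c\<close> recovers a vertex of a triangle from the midpoints of the
  two sides at this vertex and of the opposite side, so the members of classes with at least three
  elements inject into \<open>K\<^sup>3\<close>. Midpoint and recovery are kept abstract because real vectors of a given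
  dimension are a carrier set and not a type.\<close>

lemma card_le_by_midpoints:
  assumes fin: "finite V" "finite K" "finite T" and "p ` V \<subseteq> T"
    and mid: "\<And>v w. v \<in> V \<Longrightarrow> w \<in> V \<Longrightarrow> v \<noteq> w \<Longrightarrow> p v = p w \<Longrightarrow> mid v w \<in> K"
    and recover: "\<And>u v w. u \<in> V \<Longrightarrow> v \<in> V \<Longrightarrow> w \<in> V \<Longrightarrow>
                    R (mid u v) (mid u w) (mid v w) = u"
  shows "card V \<le> 2 * card T + card K ^ 3"
proof -
  define V1 where "V1 = {u \<in> V. \<exists>v\<in>V. \<exists>w\<in>V. u \<noteq> v \<and> u \<noteq> w \<and> v \<noteq> w \<and> p u = p v \<and> p u = p w}"
  have "u \<in> (\<lambda>(a, b, c). R a b c) ` (K \<times> K \<times> K)" if u: "u \<in> V1" for u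
  proof -
    obtain v w where vw: "u \<in> V" "v \<in> V" "w \<in> V" "u \<noteq> v" "u \<noteq> w" "v \<noteq> w" "p u = p v" "p u = p w"
      using u unfolding V1_def by blast
    then have "(mid u v, mid u w, mid v w) \<in> K \<times> K \<times> K" using mid by auto
    then show ?thesis using recover[OF vw(1-3)] by (force simp: image_iff)
  qed
  then have "card V1 \<le> card ((\<lambda>(a, b, c). R a b c) ` (K \<times> K \<times> K))"
    using fin by (intro card_mono) auto
  also have "\<dots> \<le> card (K \<times> K \<times> K)" using fin by (intro card_image_le) auto
  also have "\<dots> = card K ^ 3" by (simp add: card_cartesian_product power3_eq_cube)
  finally have 1: "card V1 \<le> card K ^ 3" .
  have two: "card {v \<in> V - V1. p v = t} \<le> 2" for t
  proof (rule ccontr)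
    assume "\<not> ?thesis"
    then obtain S where S: "S \<subseteq> {v \<in> V - V1. p v = t}" "card S = 3"
      using obtain_subset_with_card_n[of 3 "{v \<in> V - V1. p v = t}"] by auto
    then obtain u v w where "S = {u, v, w}" "u \<noteq> v" "u \<noteq> w" "v \<noteq> w"
      by (auto simp: card_3_iff)
    then show False using S(1) unfolding V1_def by auto
  qed
  have "V - V1 = (\<Union>t\<in>T. {v \<in> V - V1. p v = t})" using assms(4) by auto
  then have "card (V - V1) \<le> (\<Sum>t\<in>T. card {v \<in> V - V1. p v = t})"
    using card_UN_le[OF fin(3)] by metis
  also have "\<dots> \<le> (\<Sum>t\<in>T. 2)" by (intro sum_mono two)
  finally have 2: "card (V - V1) \<le> 2 * card T" by simp
  have "V1 \<subseteq> V" unfolding V1_def by auto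
  then have "card V = card (V - V1) + card V1"
    using fin(1) by (metis card_Diff_subset card_mono finite_subset le_add_diff_inverse2)
  with 1 2 show ?thesis by simp
qed

section \<open>Upper bound from parity classes of contact points\<close>

definition midpoint_vec :: "real vec \<Rightarrow> real vec \<Rightarrow> real vec" where
  "midpoint_vec x y = (1/2) \<cdot>\<^sub>v (x + y)"

definition odd_coords :: "nat \<Rightarrow> real vec \<Rightarrow> nat set" where
  "odd_coords n x = {i. i < n \<and> odd \<lfloor>x $ i\<rfloor>}"

lemma midpoint_vec_int_vecs:
  assumes "x \<in> int_vecs n" "y \<in> int_vecs n" "odd_coords n x = odd_coords n y"
  shows "midpoint_vec x y \<in> int_vecs n"
proof -
  have c: "x \<in> carrier_vec n" "y \<in> carrier_vec n" using assms unfolding int_vecs_def by auto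
  have "(x $ i + y $ i) / 2 \<in> \<int>" if i: "i < n" for i
  proof -
    have "x $ i \<in> \<int>" "y $ i \<in> \<int>" using assms i unfolding int_vecs_def by auto
    then obtain p q where pq: "x $ i = of_int p" "y $ i = of_int q" by (auto elim!: Ints_cases)
    have "i \<in> odd_coords n x \<longleftrightarrow> i \<in> odd_coords n y" using assms(3) by simp
    then have "odd p = odd q" using i unfolding odd_coords_def by (simp add: pq)
    then have "even (p + q)" by simp
    then obtain r where r: "p + q = 2 * r" by (rule evenE)
    have "x $ i + y $ i = of_int (p + q)" unfolding pq by simp
    then have "(x $ i + y $ i) / 2 = of_int r" unfolding r by simp
    then show ?thesis by simp
  qed
  then have "midpoint_vec x y $ i \<in> \<int>" if "i < n" for i
    using that c unfolding midpoint_vec_def by simp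
  moreover have "midpoint_vec x y \<in> carrier_vec n" using c unfolding midpoint_vec_def by simp
  ultimately show ?thesis unfolding int_vecs_def by blast
qed

lemma finite_int_vecs_box: "finite {x \<in> int_vecs n. \<forall>i<n. \<bar>x $ i\<bar> \<le> N}"
proof (rule finite_subset)
  let ?G = "{..<n} \<rightarrow>\<^sub>E {- \<lceil>N\<rceil>..\<lceil>N\<rceil>}"
  show "finite ((\<lambda>g. vec n (\<lambda>i. real_of_int (g i))) ` ?G)"
    by (intro finite_imageI finite_PiE) auto
  show "{x \<in> int_vecs n. \<forall>i<n. \<bar>x $ i\<bar> \<le> N} \<subseteq> (\<lambda>g. vec n (\<lambda>i. real_of_int (g i))) ` ?G"
  proof
    fix x assume x: "x \<in> {x \<in> int_vecs n. \<forall>i<n. \<bar>x $ i\<bar> \<le> N}"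
    let ?g = "restrict (\<lambda>i. \<lfloor>x $ i\<rfloor>) {..<n}"
    have "- \<lceil>N\<rceil> \<le> \<lfloor>x $ i\<rfloor>" "\<lfloor>x $ i\<rfloor> \<le> \<lceil>N\<rceil>" if "i < n" for i
    proof -
      have "\<bar>x $ i\<bar> \<le> N" using x that by auto
      then show "- \<lceil>N\<rceil> \<le> \<lfloor>x $ i\<rfloor>" "\<lfloor>x $ i\<rfloor> \<le> \<lceil>N\<rceil>" by linarith+
    qed
    then have "?g \<in> ?G" by auto
    moreover have "x = vec n (\<lambda>i. real_of_int (?g i))"
      using x by (intro eq_vecI) (auto simp: int_vecs_def Ints_def)
    ultimately show "x \<in> (\<lambda>g. vec n (\<lambda>i. real_of_int (g i))) ` ?G" by blast
  qed
qed

lemma mult_mat_vec_midpoint: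
  assumes "A \<in> carrier_mat m n" "x \<in> carrier_vec n" "y \<in> carrier_vec n" "i < m"
  shows "(A *\<^sub>v midpoint_vec x y) $ i = ((A *\<^sub>v x) $ i + (A *\<^sub>v y) $ i) / 2"
proof -
  have "row A i \<in> carrier_vec n" using assms by simp
  then have "row A i \<bullet> midpoint_vec x y = (row A i \<bullet> x + row A i \<bullet> y) / 2"
    unfolding midpoint_vec_def using assms by (simp add: scalar_prod_add_distrib[where n=n])
  then show ?thesis using assms by simp
qed

text \<open>The set \<open>F\<close> to which the pushing is applied is a box of integer points: it is finite, it contains the
  witnesses \<open>z i\<close>, and, being convex, it contains the integral midpoints of its points.\<close>

lemma subsystem_bound_upper: "subsystem_bound n k (2 * 2 ^ n + k ^ 3)"
  unfolding subsystem_bound_def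
proof (intro allI ballI impI)
  fix m A b
  assume A: "A \<in> carrier_mat m n" and b: "b \<in> carrier_vec m"
    and K: "finite (polyhedron_of A b \<inter> int_vecs n) \<and> card (polyhedron_of A b \<inter> int_vecs n) = k"
  let ?K = "polyhedron_of A b \<inter> int_vecs n"
  define f where "f i x = (A *\<^sub>v x) $ i" for i x
  define same where "same I \<longleftrightarrow> I \<subseteq> {..<m} \<and> subpolyhedron_of A b I \<inter> int_vecs n = ?K" for I
  have sub: "x \<in> subpolyhedron_of A b I \<inter> int_vecs n \<longleftrightarrow> x \<in> int_vecs n \<and> (\<forall>i\<in>I. f i x \<le> b $ i)" for x I
    using A unfolding subpolyhedron_of_def int_vecs_def f_def by auto
  have poly: "x \<in> ?K \<longleftrightarrow> x \<in> int_vecs n \<and> (\<forall>i<m. f i x \<le> b $ i)" for x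
    using A b unfolding polyhedron_of_def int_vecs_def f_def less_eq_vec_def by auto
  have "same {..<m}" unfolding same_def
  proof
    show "subpolyhedron_of A b {..<m} \<inter> int_vecs n = ?K"
      by (rule Set.set_eqI) (simp only: sub poly Ball_def lessThan_iff)
  qed simp
  then obtain I where I: "same I" and Imin: "\<And>J. same J \<Longrightarrow> card I \<le> card J"
    using ex_has_least_nat[of same "{..<m}" card] by metis
  have Im: "I \<subseteq> {..<m}" using I unfolding same_def by simp
  then have finI: "finite I" by (rule finite_subset) simp
  have IK: "x \<in> ?K \<longleftrightarrow> x \<in> int_vecs n \<and> (\<forall>i\<in>I. f i x \<le> b $ i)" for x
    using sub[of x I] I unfolding same_def by simp
  have "\<exists>z. z \<in> int_vecs n \<and> b $ i < f i z \<and> (\<forall>j\<in>I - {i}. f j z \<le> b $ j)" if i: "i \<in> I" for i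
  proof -
    have "card (I - {i}) < card I" using i finI by (rule card_Diff1_less[rotated])
    then have "\<not> same (I - {i})" using Imin not_le by blast
    then have "subpolyhedron_of A b (I - {i}) \<inter> int_vecs n \<noteq> ?K" using Im unfolding same_def by blast
    then obtain z where "\<not> (z \<in> subpolyhedron_of A b (I - {i}) \<inter> int_vecs n \<longleftrightarrow> z \<in> ?K)"
      by (metis Set.set_eqI)
    then have "z \<in> int_vecs n" "\<forall>j\<in>I - {i}. f j z \<le> b $ j" "\<not> (\<forall>j\<in>I. f j z \<le> b $ j)"
      unfolding sub IK by auto
    then show ?thesis by (metis Diff_iff empty_iff insert_iff not_le)
  qed
  then obtain z where z: "\<And>i. i \<in> I \<Longrightarrow> z i \<in> int_vecs n" "\<And>i. i \<in> I \<Longrightarrow> b $ i < f i (z i)"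
      "\<And>i j. i \<in> I \<Longrightarrow> j \<in> I - {i} \<Longrightarrow> f j (z i) \<le> b $ j"
    by metis
  define N where "N = (\<Sum>i\<in>I. \<Sum>l<n. \<bar>z i $ l\<bar>)"
  define F where "F = {x \<in> int_vecs n. \<forall>i<n. \<bar>x $ i\<bar> \<le> N}"
  have zF: "z i \<in> F" if i: "i \<in> I" for i
  proof -
    have "\<bar>z i $ l\<bar> \<le> N" if "l < n" for l
    proof -
      have "\<bar>z i $ l\<bar> \<le> (\<Sum>l<n. \<bar>z i $ l\<bar>)" using that by (intro member_le_sum) auto
      also have "\<dots> \<le> N" unfolding N_def using i finI
        by (intro member_le_sum[of i I "\<lambda>i. \<Sum>l<n. \<bar>z i $ l\<bar>"]) (auto intro: sum_nonneg)
      finally show ?thesis .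
    qed
    then show ?thesis using z(1)[OF i] unfolding F_def by auto
  qed
  have finF: "finite F" unfolding F_def by (rule finite_int_vecs_box)
  obtain v where vF: "\<And>i. i \<in> I \<Longrightarrow> v i \<in> F"
    and sep: "\<And>i j. i \<in> I \<Longrightarrow> j \<in> I \<Longrightarrow> i \<noteq> j \<Longrightarrow> f i (v j) < f i (v i)"
    and tight: "\<And>x i. x \<in> F \<Longrightarrow> (\<And>i. i \<in> I \<Longrightarrow> f i x < f i (v i)) \<Longrightarrow> i \<in> I \<Longrightarrow> f i x \<le> b $ i"
  proof (rule push_constraints[of I F "\<lambda>i. b $ i" f])
    show "\<exists>z\<in>F. b $ i < f i z \<and> (\<forall>j\<in>I - {i}. f j z \<le> b $ j)" if "i \<in> I" for i
      using zF[OF that] z(2)[OF that] z(3)[OF that] by blast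
  qed (use finI finF in blast)+
  have inj: "inj_on v I"
  proof (rule inj_onI, rule ccontr)
    fix i j assume "i \<in> I" "j \<in> I" "v i = v j" "i \<noteq> j"
    then show False using sep[of i j] by simp
  qed
  have VF: "v ` I \<subseteq> F" using vF by auto
  have Fc: "x \<in> carrier_vec n" if "x \<in> F" for x using that unfolding F_def int_vecs_def by auto
  have midK: "midpoint_vec (v i) (v j) \<in> ?K"
    if ij: "i \<in> I" "j \<in> I" "v i \<noteq> v j" and p: "odd_coords n (v i) = odd_coords n (v j)" for i j
  proof -
    let ?x = "midpoint_vec (v i) (v j)"
    have vi: "v i \<in> F" and vj: "v j \<in> F" using vF ij by auto
    have int: "?x \<in> int_vecs n" using midpoint_vec_int_vecs[OF _ _ p] vi vj unfolding F_def by auto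
    have "\<bar>?x $ l\<bar> \<le> N" if "l < n" for l
    proof -
      have "v i $ l \<le> N" "- N \<le> v i $ l" "v j $ l \<le> N" "- N \<le> v j $ l"
        using vi vj that unfolding F_def by (auto simp: abs_le_iff minus_le_iff)
      moreover have "?x $ l = (v i $ l + v j $ l) / 2"
        using Fc[OF vi] Fc[OF vj] that unfolding midpoint_vec_def by auto
      ultimately show ?thesis by (auto simp: abs_le_iff)
    qed
    then have "?x \<in> F" using int unfolding F_def by auto
    moreover have "f l ?x < f l (v l)" if l: "l \<in> I" for l
    proof -
      have *: "f l ?x = (f l (v i) + f l (v j)) / 2"
        unfolding f_def using mult_mat_vec_midpoint[OF A Fc[OF vi] Fc[OF vj]] l Im by auto
      have le: "f l (v i) \<le> f l (v l)" "f l (v j) \<le> f l (v l)"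
        using sep[of l i] sep[of l j] l ij(1,2) by fastforce+
      have "l \<noteq> i \<or> l \<noteq> j" using ij(3) by auto
      then have "f l (v i) < f l (v l) \<or> f l (v j) < f l (v l)"
        using sep[OF l ij(1)] sep[OF l ij(2)] by blast
      with le have "f l (v i) + f l (v j) < 2 * f l (v l)" by auto
      then show ?thesis unfolding * by simp
    qed
    \<comment> \<open>Strict feasibility for the pushed constraints implies feasibility for the original ones.\<close>
    ultimately have "\<forall>l\<in>I. f l ?x \<le> b $ l" using tight by blast
    then show ?thesis unfolding IK using int by blast
  qed
  have "card (v ` I) \<le> 2 * card (Pow {..<n}) + card ?K ^ 3"
  proof (rule card_le_by_midpoints[where p = "odd_coords n" and mid = midpoint_vec
        and R = "\<lambda>x y z. x + y - z"])
    show "finite (v ` I)" "finite ?K" "finite (Pow {..<n})" using finI K by auto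
    show "odd_coords n ` v ` I \<subseteq> Pow {..<n}" unfolding odd_coords_def by auto
    show "midpoint_vec x y \<in> ?K"
      if "x \<in> v ` I" "y \<in> v ` I" "x \<noteq> y" "odd_coords n x = odd_coords n y" for x y
      using that midK by blast
    show "midpoint_vec x y + midpoint_vec x w - midpoint_vec y w = x"
      if "x \<in> v ` I" "y \<in> v ` I" "w \<in> v ` I" for x y w
    proof -
      have "dim_vec x = n" "dim_vec y = n" "dim_vec w = n" using that VF Fc carrier_vecD by blast+
      then show ?thesis unfolding midpoint_vec_def by (intro eq_vecI) (simp_all add: field_simps)
    qed
  qed
  then have "card I \<le> 2 * 2 ^ n + k ^ 3"
    using K by (simp add: card_image[OF inj] card_Pow)
  moreover have "subpolyhedron_of A b I \<inter> int_vecs n = ?K" using I unfolding same_def by (rule conjunct2)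
  ultimately show "\<exists>I\<subseteq>{..<m}. card I \<le> 2 * 2 ^ n + k ^ 3 \<and> subpolyhedron_of A b I \<inter> int_vecs n = ?K"
    by (intro exI[of _ I] conjI Im)
qed

section \<open>Lower bound from signed indicator vectors\<close>

definition lin :: "nat \<Rightarrow> (nat \<Rightarrow> real) \<Rightarrow> real vec \<Rightarrow> real" where
  "lin n a x = (\<Sum>j<n. a j * x $ j)"

definition sat :: "nat \<Rightarrow> (nat \<Rightarrow> real) \<times> real \<Rightarrow> real vec \<Rightarrow> bool" where
  "sat n e x \<longleftrightarrow> lin n (fst e) x \<le> snd e"

text \<open>The constraint \<open>q d\<close> excludes \<open>w d\<close>, and no other constraint does. A subsystem omitting all copies of \<open>q d\<close> would
  therefore admit the additional integer point \<open>w d\<close>.\<close>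

lemma card_essential_le:
  assumes bound: "subsystem_bound n k c" and fin: "finite E" "finite D"
    and w: "\<And>d. d \<in> D \<Longrightarrow> w d \<in> int_vecs n"
    and wE: "\<And>d e. d \<in> D \<Longrightarrow> e \<in> E \<Longrightarrow> sat n e (w d)"
    and wq: "\<And>d d'. d \<in> D \<Longrightarrow> d' \<in> D \<Longrightarrow> sat n (q d') (w d) \<longleftrightarrow> d \<noteq> d'"
    and P: "finite {x \<in> int_vecs n. \<forall>e\<in>E \<union> q ` D. sat n e x}"
      "card {x \<in> int_vecs n. \<forall>e\<in>E \<union> q ` D. sat n e x} = k"
  shows "card D \<le> c"
proof -
  have "finite (E \<union> q ` D)" using fin by auto
  then obtain h where h: "bij_betw h {0..<card (E \<union> q ` D)} (E \<union> q ` D)"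
    using ex_bij_betw_nat_finite by blast
  define m where "m = card (E \<union> q ` D)"
  define A where "A = mat m n (\<lambda>(i, j). fst (h i) j)"
  define b where "b = vec m (\<lambda>i. snd (h i))"
  have himg: "h ` {..<m} = E \<union> q ` D" using h unfolding m_def bij_betw_def lessThan_atLeast0 by simp
  have A: "A \<in> carrier_mat m n" and b: "b \<in> carrier_vec m" unfolding A_def b_def by auto
  have row: "(A *\<^sub>v x) $ i \<le> b $ i \<longleftrightarrow> sat n (h i) x" if "x \<in> int_vecs n" "i < m" for x i
    using that unfolding A_def b_def sat_def lin_def int_vecs_def
    by (auto simp: scalar_prod_def lessThan_atLeast0)
  have sub: "x \<in> subpolyhedron_of A b I \<inter> int_vecs n \<longleftrightarrow> x \<in> int_vecs n \<and> (\<forall>i\<in>I. sat n (h i) x)"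
    if "I \<subseteq> {..<m}" for x I
  proof -
    have "x \<in> subpolyhedron_of A b I \<inter> int_vecs n \<longleftrightarrow>
        x \<in> int_vecs n \<and> (\<forall>i\<in>I. (A *\<^sub>v x) $ i \<le> b $ i)"
      using A unfolding subpolyhedron_of_def int_vecs_def by auto
    then show ?thesis using row that by blast
  qed
  have "x \<in> polyhedron_of A b \<inter> int_vecs n \<longleftrightarrow> x \<in> int_vecs n \<and> (\<forall>i<m. sat n (h i) x)" for x
  proof -
    have "x \<in> polyhedron_of A b \<inter> int_vecs n \<longleftrightarrow>
        x \<in> int_vecs n \<and> (\<forall>i<m. (A *\<^sub>v x) $ i \<le> b $ i)"
      using A b unfolding polyhedron_of_def int_vecs_def less_eq_vec_def by auto
    then show ?thesis using row by blast
  qed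
  then have poly: "polyhedron_of A b \<inter> int_vecs n = {x \<in> int_vecs n. \<forall>e\<in>E \<union> q ` D. sat n e x}"
    unfolding himg[symmetric] by auto
  from bound A b P obtain I where I: "I \<subseteq> {..<m}" "card I \<le> c"
    and same: "subpolyhedron_of A b I \<inter> int_vecs n = polyhedron_of A b \<inter> int_vecs n"
    unfolding subsystem_bound_def poly[symmetric] by blast
  have "q ` D \<subseteq> h ` I"
  proof
    fix e assume "e \<in> q ` D"
    then obtain d where d: "d \<in> D" "e = q d" by blast
    have "\<not> sat n (q d) (w d)" using wq d by blast
    then have "w d \<notin> subpolyhedron_of A b I \<inter> int_vecs n" unfolding same poly using d by blast
    then obtain i where i: "i \<in> I" "\<not> sat n (h i) (w d)" using sub[OF I(1)] w[OF d(1)] by blast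
    have "h i \<in> E \<union> q ` D" using i I himg by blast
    then have "h i = q d"
    proof
      assume "h i \<in> q ` D"
      then obtain d' where "d' \<in> D" "h i = q d'" by blast
      then show ?thesis using i(2) wq[OF d(1)] by metis
    qed (use i(2) wE[OF d(1)] in blast)
    then show "e \<in> h ` I" using imageI[OF i(1), of h] d(2) by simp
  qed
  moreover have "finite I" using I(1) finite_subset by blast
  ultimately have "card (q ` D) \<le> card I" by (rule surj_card_le[rotated])
  moreover have "inj_on q D"
  proof (rule inj_onI)
    fix d d' assume d: "d \<in> D" "d' \<in> D" and eq: "q d = q d'"
    show "d = d'" using wq[OF d] wq[OF d(1) d(1)] eq by simp
  qed
  ultimately show ?thesis using I(2) by (simp add: card_image)
qed

definition sgn_ind :: "nat \<Rightarrow> real \<times> nat set \<Rightarrow> real vec" where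
  "sgn_ind n d = vec n (\<lambda>i. if i \<in> snd d then fst d else 0)"

definition sgn_sets :: "nat \<Rightarrow> (real \<times> nat set) set" where
  "sgn_sets n = {1, -1} \<times> (Pow {..<n} - {{}})"

text \<open>For \<open>d = (s, S)\<close> this is \<open>n \<Sum>\<^sub>S s x\<^sub>j - \<Sum>\<^sub>C s x\<^sub>j \<le> n |S| - 1\<close> with \<open>C\<close> the complement of \<open>S\<close>. The weight \<open>n\<close> on \<open>S\<close> is
  chosen because \<open>C\<close> has at most \<open>n - 1\<close> elements: coordinates outside \<open>S\<close> can never make up for a missing element
  of \<open>S\<close>, while each surplus element still costs 1.\<close>

definition cut_off :: "nat \<Rightarrow> real \<times> nat set \<Rightarrow> (nat \<Rightarrow> real) \<times> real" where
  "cut_off n d = (\<lambda>j. if j \<in> snd d then real n * fst d else - fst d, real n * real (card (snd d)) - 1)"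

text \<open>The index \<open>n\<close> lies outside the range of coordinates, so that \<open>x\<^sub>n\<close> acts as 0 and the bounds \<open>\<bar>x\<^sub>i\<bar> \<le> 1\<close> are
  among the constraints \<open>x\<^sub>i - x\<^sub>j \<le> 1\<close>.\<close>

definition diff_constraints :: "nat \<Rightarrow> ((nat \<Rightarrow> real) \<times> real) set" where
  "diff_constraints n =
    (\<lambda>(i, j). (\<lambda>l. of_bool (l = i) - of_bool (l = j), 1)) ` ({..n} \<times> {..n})"

lemma finite_sgn_sets: "finite (sgn_sets n)"
  unfolding sgn_sets_def by auto

lemma card_sgn_sets: "card (sgn_sets n) = 2 * (2 ^ n - 1)"
  unfolding sgn_sets_def by (simp add: card_cartesian_product card_Diff_subset card_Pow)

lemma sgn_ind_int_vecs: "d \<in> sgn_sets n \<Longrightarrow> sgn_ind n d \<in> int_vecs n"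
  unfolding sgn_ind_def sgn_sets_def int_vecs_def by auto

lemma inj_on_sgn_ind: "inj_on (sgn_ind n) (sgn_sets n)"
proof (rule inj_onI)
  fix d e assume d: "d \<in> sgn_sets n" and e: "e \<in> sgn_sets n" and eq: "sgn_ind n d = sgn_ind n e"
  have *: "(if i \<in> snd d then fst d else 0) = (if i \<in> snd e then fst e else 0)" if "i < n" for i
    using arg_cong[OF eq, of "\<lambda>x. x $ i"] that unfolding sgn_ind_def by simp
  have nz: "fst d \<noteq> 0" "fst e \<noteq> 0" and s: "snd d \<subseteq> {..<n}" "snd e \<subseteq> {..<n}" "snd d \<noteq> {}"
    using d e unfolding sgn_sets_def by auto
  have S: "snd d = snd e" using * nz s by (metis lessThan_iff subset_antisym subset_iff)
  obtain i where "i \<in> snd d" using s by blast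
  then have "fst d = fst e" using *[of i] s S by auto
  with S show "d = e" by (simp add: prod_eq_iff)
qed

lemma sgn_ind_neq_0: "d \<in> sgn_sets n \<Longrightarrow> sgn_ind n d \<noteq> 0\<^sub>v n"
proof
  assume d: "d \<in> sgn_sets n" and eq: "sgn_ind n d = 0\<^sub>v n"
  have "snd d \<noteq> {}" "snd d \<subseteq> {..<n}" using d unfolding sgn_sets_def by auto
  then obtain i where i: "i \<in> snd d" "i < n" by blast
  then have "fst d = 0" using arg_cong[OF eq, of "\<lambda>x. x $ i"] unfolding sgn_ind_def by simp
  then show False using d unfolding sgn_sets_def by auto
qed

lemma lin_cut_off_sgn_ind:
  assumes "d \<in> sgn_sets n" "e \<in> sgn_sets n"
  shows "lin n (fst (cut_off n d)) (sgn_ind n e) =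
    fst d * fst e * (real n * real (card (snd d \<inter> snd e)) - real (card (snd e - snd d)))"
proof -
  have s: "snd d \<subseteq> {..<n}" "snd e \<subseteq> {..<n}" using assms unfolding sgn_sets_def by auto
  then have fin: "finite (snd e)" "finite (snd d)" using finite_subset by blast+
  have "lin n (fst (cut_off n d)) (sgn_ind n e) =
      (\<Sum>j<n. if j \<in> snd e then (if j \<in> snd d then real n * fst d else - fst d) * fst e else 0)"
    unfolding lin_def cut_off_def sgn_ind_def by (intro sum.cong) auto
  also have "\<dots> = (\<Sum>j\<in>snd e. (if j \<in> snd d then real n * fst d else - fst d) * fst e)"
    using s by (simp add: sum.inter_restrict[symmetric] Int_absorb1)
  also have "\<dots> = (\<Sum>j\<in>snd d \<inter> snd e. real n * fst d * fst e) + (\<Sum>j\<in>snd e - snd d. - fst d * fst e)"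
    using fin by (simp add: if_distribR sum.If_cases if_distrib Int_commute Diff_eq cong: if_cong)
  also have "\<dots> = fst d * fst e * (real n * real (card (snd d \<inter> snd e)) - real (card (snd e - snd d)))"
    by (simp add: algebra_simps)
  finally show ?thesis .
qed

text \<open>The left-hand side equals \<open>n |S|\<close> at \<open>s1\<^sub>S\<close>. With the same sign, a set \<open>T\<close> that misses an element of \<open>S\<close> loses at
  least \<open>n\<close>, and a proper superset loses at least 1. With the opposite sign the value is at most
  \<open>|T - S| \<le> n - |S| \<le> n |S| - 1\<close>.\<close>

lemma sat_cut_off_sgn_ind:
  assumes d: "d \<in> sgn_sets n" and e: "e \<in> sgn_sets n"
  shows "sat n (cut_off n d) (sgn_ind n e) \<longleftrightarrow> e \<noteq> d"
proof -
  let ?S = "snd d" and ?T = "snd e"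
  have s: "?S \<subseteq> {..<n}" "?T \<subseteq> {..<n}" "?S \<noteq> {}" "?T \<noteq> {}" and
    sg: "fst d = 1 \<or> fst d = -1" "fst e = 1 \<or> fst e = -1"
    using d e unfolding sgn_sets_def by auto
  have fin: "finite ?S" "finite ?T" using s finite_subset by blast+
  have S1: "1 \<le> card ?S" using s(3) fin by (simp add: Suc_leI card_gt_0_iff)
  have n1: "1 \<le> n" using s by (cases n) auto
  have nS: "n \<le> n * card ?S" using S1 by simp
  have sat: "sat n (cut_off n d) (sgn_ind n e) \<longleftrightarrow> fst d * fst e *
      (real n * real (card (?S \<inter> ?T)) - real (card (?T - ?S))) \<le> real n * real (card ?S) - 1"
    unfolding sat_def lin_cut_off_sgn_ind[OF d e] by (simp add: cut_off_def)
  show ?thesis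
  proof (cases "fst d = fst e")
    case same: True
    then have sat: "sat n (cut_off n d) (sgn_ind n e) \<longleftrightarrow>
        real n * real (card (?S \<inter> ?T)) - real (card (?T - ?S)) \<le> real n * real (card ?S) - 1"
      using sat sg by auto
    consider "?T = ?S" | "?S \<subset> ?T" | "\<not> ?S \<subseteq> ?T" by blast
    then show ?thesis
    proof cases
      case 1
      then show ?thesis using same by (simp add: sat prod_eq_iff)
    next
      case 2
      then have "card (?T - ?S) \<noteq> 0" using fin by auto
      then have "1 \<le> real (card (?T - ?S))" by linarith
      moreover have "?S \<inter> ?T = ?S" using 2 by auto
      ultimately show ?thesis using 2 by (auto simp: sat)
    next
      case 3
      then have "card (?S \<inter> ?T) < card ?S" using fin by (intro psubset_card_mono) auto
      then have "real (card (?S \<inter> ?T)) \<le> real (card ?S) - 1" by linarith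
      then have "real n * real (card (?S \<inter> ?T)) \<le> real n * (real (card ?S) - 1)"
        by (intro mult_left_mono) auto
      then have "real n * real (card (?S \<inter> ?T)) \<le> real n * real (card ?S) - 1"
        using n1 by (simp add: algebra_simps)
      then show ?thesis using 3 by (auto simp: sat)
    qed
  next
    case False
    then have opp: "fst d * fst e = -1" using sg by auto
    have "real (card (?T - ?S)) \<le> real n * real (card ?S) - 1"
    proof -
      have "card (?T - ?S) \<le> card ({..<n} - ?S)" using s by (intro card_mono) auto
      also have "\<dots> = n - card ?S" using s fin by (simp add: card_Diff_subset)
      finally have "card (?T - ?S) + 1 \<le> n" using S1 n1 by linarith
      then have "card (?T - ?S) + 1 \<le> n * card ?S" using nS by linarith
      then have "real (card (?T - ?S)) + 1 \<le> real n * real (card ?S)"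
        by (metis of_nat_1 of_nat_add of_nat_le_iff of_nat_mult)
      then show ?thesis by simp
    qed
    moreover have "0 \<le> real n * real (card (?S \<inter> ?T))" by simp
    ultimately have "sat n (cut_off n d) (sgn_ind n e)" unfolding sat opp mult_minus1 by linarith
    then show ?thesis using False by auto
  qed
qed

lemma sat_cut_off_0: "d \<in> sgn_sets n \<Longrightarrow> sat n (cut_off n d) (0\<^sub>v n)"
proof -
  assume d: "d \<in> sgn_sets n"
  then have s: "snd d \<subseteq> {..<n}" "snd d \<noteq> {}" unfolding sgn_sets_def by auto
  then have "0 < n" "0 < card (snd d)" using finite_subset[OF s(1)] by (auto simp: card_gt_0_iff)
  then have "0 < n * card (snd d)" by simp
  then have "1 \<le> real n * real (card (snd d))"
    by (metis Suc_leI of_nat_1 One_nat_def of_nat_le_iff of_nat_mult)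
  then show ?thesis unfolding sat_def lin_def cut_off_def by simp
qed

lemma sat_diff_constraints:
  "(\<forall>e\<in>diff_constraints n. sat n e x) \<longleftrightarrow>
    (\<forall>i\<le>n. \<forall>j\<le>n. (if i < n then x $ i else 0) - (if j < n then x $ j else 0) \<le> 1)"
proof -
  have delta: "(\<Sum>l<n. of_bool (l = i) * x $ l) = (if i < n then x $ i else 0)" for i
  proof -
    have "(\<Sum>l<n. of_bool (l = i) * x $ l) = (\<Sum>l<n. if l = i then x $ l else 0)"
      by (rule sum.cong) auto
    then show ?thesis by simp
  qed
  have "lin n (\<lambda>l. of_bool (l = i) - of_bool (l = j)) x =
      (if i < n then x $ i else 0) - (if j < n then x $ j else 0)" for i j
    unfolding lin_def left_diff_distrib sum_subtractf delta by (rule refl)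
  then show ?thesis unfolding diff_constraints_def sat_def by auto
qed

text \<open>All coordinates are in \<open>{-1, 0, 1}\<close>, and \<open>1\<close> and \<open>-1\<close> cannot both occur, as their difference is 2.\<close>

lemma int_points_diff_constraints:
  assumes x: "x \<in> int_vecs n"
  shows "(\<forall>e\<in>diff_constraints n. sat n e x) \<longleftrightarrow> x \<in> insert (0\<^sub>v n) (sgn_ind n ` sgn_sets n)"
proof
  assume "x \<in> insert (0\<^sub>v n) (sgn_ind n ` sgn_sets n)"
  then show "\<forall>e\<in>diff_constraints n. sat n e x"
    unfolding sat_diff_constraints sgn_ind_def sgn_sets_def by auto
next
  assume "\<forall>e\<in>diff_constraints n. sat n e x"
  then have diff: "(if i < n then x $ i else 0) - (if j < n then x $ j else 0) \<le> 1"
    if "i \<le> n" "j \<le> n" for i j using that sat_diff_constraints by blast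
  have le1: "x $ i \<le> 1" and ge1: "-1 \<le> x $ i" if "i < n" for i
    using diff[of i n] diff[of n i] that by auto
  have dij: "x $ i - x $ j \<le> 1" if "i < n" "j < n" for i j using diff[of i j] that by auto
  have vals: "x $ i = -1 \<or> x $ i = 0 \<or> x $ i = 1" if i: "i < n" for i
  proof -
    obtain z where z: "x $ i = of_int z" using x i unfolding int_vecs_def by (auto elim!: Ints_cases)
    then have "-1 \<le> z" "z \<le> 1" using le1[OF i] ge1[OF i] by linarith+
    then have "z = -1 \<or> z = 0 \<or> z = 1" by linarith
    then show ?thesis using z by auto
  qed
  define S where "S = {i. i < n \<and> x $ i \<noteq> 0}"
  obtain s :: real where s: "s = 1 \<or> s = -1" "\<And>i. i \<in> S \<Longrightarrow> x $ i = s"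
  proof (cases "\<exists>i<n. x $ i = 1")
    case True
    then have "x $ j \<noteq> -1" if "j < n" for j using dij[of _ j] that by force
    then show ?thesis using that[of 1] vals unfolding S_def by blast
  next
    case False
    then show ?thesis using that[of "-1"] vals unfolding S_def by blast
  qed
  have eq: "x = sgn_ind n (s, S)"
  proof (rule eq_vecI)
    show "dim_vec x = dim_vec (sgn_ind n (s, S))" using x unfolding sgn_ind_def int_vecs_def by auto
    fix i assume "i < dim_vec (sgn_ind n (s, S))"
    then have i: "i < n" unfolding sgn_ind_def by simp
    show "x $ i = sgn_ind n (s, S) $ i"
    proof (cases "i \<in> S")
      case True
      then show ?thesis using s(2)[OF True] i unfolding sgn_ind_def by simp
    next
      case False
      then have "x $ i = 0" using i unfolding S_def by blast
      then show ?thesis using False i unfolding sgn_ind_def by simp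
    qed
  qed
  show "x \<in> insert (0\<^sub>v n) (sgn_ind n ` sgn_sets n)"
  proof (cases "S = {}")
    case True
    then show ?thesis using eq by (auto simp: sgn_ind_def zero_vec_def)
  next
    case False
    then have "(s, S) \<in> sgn_sets n" using s(1) unfolding sgn_sets_def S_def by auto
    then show ?thesis using eq by blast
  qed
qed

lemma finite_diff_constraints: "finite (diff_constraints n)"
  unfolding diff_constraints_def by auto

lemma sat_diff_sgn_ind:
  "d \<in> sgn_sets n \<Longrightarrow> e \<in> diff_constraints n \<Longrightarrow> sat n e (sgn_ind n d)"
  using int_points_diff_constraints[OF sgn_ind_int_vecs] by blast

lemma subsystem_bound_lower:
  assumes bound: "subsystem_bound n k c" and k: "1 \<le> k"
  shows "2 * 2 ^ n \<le> c + k + 1"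
proof (cases "k - 1 \<le> card (sgn_sets n)")
  case False
  \<comment> \<open>With fewer than \<open>k - 1\<close> signed indicators in total, \<open>2\<^sup>n\<^sup>+\<^sup>1\<close> is itself at most \<open>k\<close>.\<close>
  moreover have "1 \<le> (2::nat) ^ n" by simp
  ultimately show ?thesis unfolding card_sgn_sets by linarith
next
  case True
  then obtain U where U: "U \<subseteq> sgn_sets n" "card U = k - 1" "finite U"
    using obtain_subset_with_card_n by blast
  define D where "D = sgn_sets n - U"
  let ?E = "diff_constraints n"
  have P: "{x \<in> int_vecs n. \<forall>e\<in>?E \<union> cut_off n ` D. sat n e x} = insert (0\<^sub>v n) (sgn_ind n ` U)" (is "?P = ?Q")
  proof (intro Set.set_eqI iffI)
    fix x assume x: "x \<in> ?P"
    then consider "x = 0\<^sub>v n" | d where "d \<in> sgn_sets n" "x = sgn_ind n d"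
      using int_points_diff_constraints[of x n] by blast
    then show "x \<in> ?Q"
    proof cases
      case 2
      then have "d \<notin> D" using x sat_cut_off_sgn_ind[of d n d] by blast
      then show ?thesis using 2 unfolding D_def by blast
    qed simp
  next
    fix x assume "x \<in> ?Q"
    then consider "x = 0\<^sub>v n" | d where "d \<in> U" "x = sgn_ind n d" by blast
    then show "x \<in> ?P"
    proof cases
      case 1
      moreover have "0\<^sub>v n \<in> int_vecs n" unfolding int_vecs_def by auto
      ultimately show ?thesis
        using int_points_diff_constraints[of x n] sat_cut_off_0 unfolding D_def by blast
    next
      case 2
      then have d: "d \<in> sgn_sets n" using U by blast
      have "sat n e x" if "e \<in> ?E" for e using that sat_diff_sgn_ind[OF d] 2 by blast
      moreover have "sat n (cut_off n d') x" if "d' \<in> D" for d'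
        using that 2 d sat_cut_off_sgn_ind[of d' n d] unfolding D_def by blast
      ultimately show ?thesis using sgn_ind_int_vecs[OF d] 2(2) by blast
    qed
  qed
  have "0\<^sub>v n \<notin> sgn_ind n ` U" using sgn_ind_neq_0 U by fastforce
  then have "card (insert (0\<^sub>v n) (sgn_ind n ` U)) = k"
    using U k card_image[OF inj_on_subset[OF inj_on_sgn_ind U(1)]] by simp
  then have cardP: "card {x \<in> int_vecs n. \<forall>e\<in>?E \<union> cut_off n ` D. sat n e x} = k" unfolding P .
  have finP: "finite {x \<in> int_vecs n. \<forall>e\<in>?E \<union> cut_off n ` D. sat n e x}"
    unfolding P using U by simp
  have DU: "d \<in> sgn_sets n" if "d \<in> D" for d using that unfolding D_def by blast
  have finD: "finite D" unfolding D_def using finite_sgn_sets by simp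
  have "card D \<le> c"
  proof (rule card_essential_le[OF bound finite_diff_constraints finD _ _ _ finP cardP])
    show "sgn_ind n d \<in> int_vecs n" if "d \<in> D" for d
      using sgn_ind_int_vecs[OF DU[OF that]] .
    show "sat n e (sgn_ind n d)" if "d \<in> D" "e \<in> ?E" for d e
      using sat_diff_sgn_ind[OF DU[OF that(1)] that(2)] .
    show "sat n (cut_off n d') (sgn_ind n d) \<longleftrightarrow> d \<noteq> d'" if "d \<in> D" "d' \<in> D" for d d'
      using sat_cut_off_sgn_ind[OF DU[OF that(2)] DU[OF that(1)]] .
  qed
  moreover have "card D = 2 * (2 ^ n - 1) - (k - 1)"
    unfolding D_def using U by (simp add: card_Diff_subset card_sgn_sets)
  moreover have "1 \<le> (2::nat) ^ n" by simp
  ultimately show ?thesis using k by linarith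
qed

theorem mainTheorem6:
  shows "\<forall>k\<ge>1. \<exists>D::real. \<forall>n\<ge>1. \<bar>real (helly_c n k) - 2 ^ (n + 1)\<bar> \<le> D"
proof (intro allI impI)
  fix k :: nat assume k: "1 \<le> k"
  have "\<bar>real (helly_c n k) - 2 ^ (n + 1)\<bar> \<le> real (k ^ 3 + k + 1)" for n
  proof -
    have "helly_c n k \<le> 2 * 2 ^ n + k ^ 3"
      unfolding helly_c_def by (rule Least_le) (rule subsystem_bound_upper)
    then have "real (helly_c n k) \<le> real (2 * 2 ^ n + k ^ 3)" by (simp only: of_nat_le_iff)
    then have up: "real (helly_c n k) - 2 ^ (n + 1) \<le> real (k ^ 3)" by simp
    have "2 * 2 ^ n \<le> helly_c n k + k + 1"
      unfolding helly_c_def by (rule subsystem_bound_lower[OF LeastI k]) (rule subsystem_bound_upper)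
    then have "real (2 * 2 ^ n) \<le> real (helly_c n k + k + 1)" by (simp only: of_nat_le_iff)
    then have low: "2 ^ (n + 1) - real (helly_c n k) \<le> real (k + 1)" by simp
    have "real (k ^ 3) \<le> real (k ^ 3 + k + 1)" "real (k + 1) \<le> real (k ^ 3 + k + 1)"
      by (simp_all only: of_nat_le_iff)
    with up low show ?thesis by linarith
  qed
  then show "\<exists>D::real. \<forall>n\<ge>1. \<bar>real (helly_c n k) - 2 ^ (n + 1)\<bar> \<le> D" by blast
qed

end
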